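(* Let $\mu_X$ and $\mu_X'$ be the probability measures on $\mathbb{T}$ defined by $$\mu_X=\frac{1}{\#\Omega(X)}\sum_{(T_{p,q},\alpha)\in\Omega(X)}\delta_\alpha,\qquad \mu_X'=\frac{1}{\#\Omega_1(X)}\sum_{(T_{p,q},\alpha)\in\Omega_1(X)}\delta_\alpha,$$ where $\delta_\alpha$ denotes the Dirac mass at $\alpha\in\mathbb{T}$. Then both $\mu_X$ and $\mu_X'$ converge weakly to $\mu_{\mathbb{T}}$ as $X\to\infty$.
   Context: $\mathbb{T}=\{z\in\mathbb{C}:|z|=1\}$ and $\mu_{\mathbb{T}}$ is the normalized Haar measure on $\mathbb{T}$. For positive integers $p,q$ let $T_{p,q}$ be the $(p,q)$-torus link, $d=\gcd(p,q)$, $L=\operatorname{lcm}(p,q)$, with single-variable Alexander polynomial $$\Delta_{p,q}(t)=\frac{(t^{L}-1)^{d}(t-1)}{(t^{p}-1)(t^{q}-1)}$$ (for $d=1$ this is the Alexander polynomial $\frac{(t^{pq}-1)(t-1)}{(t^p-1)(t^q-1)}$ of the torus knot). All its roots are roots of unity. Links are indexed by ordered pairs $(p,q)$. For $X>0$, $\Omega(X)$ is the multiset of pairs $(T_{p,q},\alpha)$ with $1\le p,q\le X$ and $\alpha$ a root of $\Delta_{p,q}(t)$, counted with multiplicity; $\Omega_1(X)$ is the set of pairs $(T_{p,q},\alpha)$ with $1\le p,q\le X$, $\gcd(p,q)=1$ and $\alpha$ a root of $\Delta_{p,q}(t)$. The measures are considered for $X$ large enough that $\Omega(X)$ and $\Omega_1(X)$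 are nonempty. *)

theory Defs
  imports
    "HOL-Probability.Probability"
    "HOL-Computational_Algebra.Computational_Algebra"
begin

definition circle_borel :: "complex measure" where
  "circle_borel = restrict_space borel (sphere 0 1)"

definition normalized_haar :: "complex measure \<Rightarrow> bool" where
  "normalized_haar M \<longleftrightarrow> sets M = sets circle_borel \<and> prob_space M \<and>
     (\<forall>z\<in>sphere 0 1. distr M M (\<lambda>w. z * w) = M)"

(* Well defined by ex1_normalized_haar below. *)
definition haar_circle :: "complex measure" where
  "haar_circle = (THE M. normalized_haar M)"

definition weakly_converges :: "('i \<Rightarrow> 'a::topological_space measure) \<Rightarrow> 'a measure \<Rightarrow> 'i filter \<Rightarrow> bool" where
  "weakly_converges \<mu> M F \<longleftrightarrow>
     (\<forall>f :: 'a \<Rightarrow> real. continuous_on (space M) f \<and> bounded (f ` space M) \<longrightarrow>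
        ((\<lambda>i. \<integral>x. f x \<partial>\<mu> i) \<longlongrightarrow> (\<integral>x. f x \<partial>M)) F)"

(* The polynomial division is exact, see torus_alexander_exact. *)
definition torus_alexander :: "nat \<Rightarrow> nat \<Rightarrow> complex poly" where
  "torus_alexander p q =
     ((monom 1 (lcm p q) - 1) ^ gcd p q * (monom 1 1 - 1)) div
     ((monom 1 p - 1) * (monom 1 q - 1))"

(* The link T(p,q) is represented by the ordered pair (p,q). *)
definition torus_indices :: "real \<Rightarrow> (nat \<times> nat) set" where
  "torus_indices X = {(p, q). 1 \<le> p \<and> real p \<le> X \<and> 1 \<le> q \<and> real q \<le> X}"

definition Omega :: "real \<Rightarrow> ((nat \<times> nat) \<times> complex) multiset" where
  "Omega X = (\<Sum>(p, q)\<in>torus_indices X. image_mset (Pair (p, q)) (proots (torus_alexander p q)))"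

definition Omega1 :: "real \<Rightarrow> ((nat \<times> nat) \<times> complex) set" where
  "Omega1 X = {((p, q), \<alpha>). (p, q) \<in> torus_indices X \<and> coprime p q \<and> poly (torus_alexander p q) \<alpha> = 0}"

(* measure_of would yield the null measure if its last argument were not a measure;
   emeasure_dirac_average shows that it is one. *)
definition dirac_average :: "('k \<times> complex) multiset \<Rightarrow> complex measure" where
  "dirac_average S = measure_of (space circle_borel) (sets circle_borel)
     (\<lambda>A. (\<Sum>(k, \<alpha>)\<in>#S. emeasure (return circle_borel \<alpha>) A) / of_nat (size S))"

definition root_measure :: "real \<Rightarrow> complex measure" where
  "root_measure X = dirac_average (Omega X)"

definition root_measure1 :: "real \<Rightarrow> complex measure" where
  "root_measure1 X = dirac_average (mset_set (Omega1 X))"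


lemma space_circle_borel [simp]: "space circle_borel = sphere 0 1"
  by (simp add: circle_borel_def space_restrict_space)

definition circle_param :: "real \<Rightarrow> complex" where
  "circle_param t = cis (2 * pi * t)"

lemma norm_circle_param [simp]: "norm (circle_param t) = 1"
  by (simp add: circle_param_def)

lemma circle_param_plus_1 [simp]: "circle_param (t + 1) = circle_param t"
  by (simp add: circle_param_def ring_distribs cis_mult[symmetric] del: cis_mult)

lemma circle_param_add: "circle_param (s + t) = circle_param s * circle_param t"
  by (simp add: circle_param_def ring_distribs cis_mult)

lemma circle_param_measurable [measurable]: "circle_param \<in> borel \<rightarrow>\<^sub>M circle_borel"
  unfolding circle_borel_def circle_param_def
  by (intro measurable_restrict_space2 borel_measurable_continuous_onI continuous_intros) auto

lemma circle_param_surj: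
  assumes "z \<in> sphere 0 1" obtains s where "0 \<le> s" "s < 1" "z = circle_param s"
proof -
  have z: "z = cis (Arg2pi z)"
    using assms Arg2pi_eq[of z] by (simp add: cis_conv_exp)
  show ?thesis
    by (rule that[of "Arg2pi z / (2 * pi)"])
       (use Arg2pi_ge_0[of z] Arg2pi_lt_2pi[of z] z in \<open>auto simp: circle_param_def field_simps\<close>)
qed

lemma circle_mult_measurable [measurable]:
  "(\<lambda>(z, w). z * w) \<in> circle_borel \<Otimes>\<^sub>M circle_borel \<rightarrow>\<^sub>M circle_borel"
proof -
  have id: "(\<lambda>x. x) \<in> circle_borel \<rightarrow>\<^sub>M borel"
    unfolding circle_borel_def by (rule measurable_restrict_space1) simp
  have "(\<lambda>x. fst x * snd x) \<in> circle_borel \<Otimes>\<^sub>M circle_borel \<rightarrow>\<^sub>M borel"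
    by (intro borel_measurable_times measurable_compose[OF measurable_fst id]
          measurable_compose[OF measurable_snd id])
  thus ?thesis
    unfolding circle_borel_def case_prod_unfold
    by (intro measurable_restrict_space2)
       (auto simp: space_pair_measure space_restrict_space norm_mult)
qed

lemma nn_integral_periodic_shift:
  fixes g :: "real \<Rightarrow> ennreal"
  assumes [measurable]: "g \<in> borel_measurable borel"
    and per: "\<And>t. g (t + 1) = g t" and s: "0 \<le> s" "s < 1"
  shows "(\<integral>\<^sup>+t\<in>{0..<1}. g (s + t) \<partial>lborel) = (\<integral>\<^sup>+t\<in>{0..<1}. g t \<partial>lborel)"
proof -
  have shift: "(\<integral>\<^sup>+t. f t \<partial>lborel) = (\<integral>\<^sup>+t. f (c + t) \<partial>lborel)"
    if "f \<in> borel_measurable borel" for f :: "real \<Rightarrow> ennreal" and c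
    using nn_integral_real_affine[of f 1 c] that by simp
  have "(\<integral>\<^sup>+t\<in>{0..<1}. g (s + t) \<partial>lborel) = (\<integral>\<^sup>+t. g t * indicator {s..<s+1} t \<partial>lborel)"
    by (subst (2) shift[of _ s]) (auto intro!: nn_integral_cong simp: indicator_def)
  also have "\<dots> = (\<integral>\<^sup>+t. g t * indicator {s..<1} t + g t * indicator {1..<s+1} t \<partial>lborel)"
    using s by (intro nn_integral_cong) (auto simp: indicator_def)
  also have "\<dots> = (\<integral>\<^sup>+t. g t * indicator {s..<1} t \<partial>lborel) + (\<integral>\<^sup>+t. g t * indicator {1..<s+1} t \<partial>lborel)"
    by (rule nn_integral_add) auto
  also have "(\<integral>\<^sup>+t. g t * indicator {1..<s+1} t \<partial>lborel) = (\<integral>\<^sup>+t. g t * indicator {0..<s} t \<partial>lborel)"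
    by (subst shift[of _ 1])
       (auto intro!: nn_integral_cong simp: indicator_def per add.commute[of 1])
  also have "(\<integral>\<^sup>+t. g t * indicator {s..<1} t \<partial>lborel) + \<dots> =
      (\<integral>\<^sup>+t. g t * indicator {s..<1} t + g t * indicator {0..<s} t \<partial>lborel)"
    by (rule nn_integral_add[symmetric]) auto
  also have "\<dots> = (\<integral>\<^sup>+t\<in>{0..<1}. g t \<partial>lborel)"
    using s by (intro nn_integral_cong) (auto simp: indicator_def)
  finally show ?thesis .
qed

lemma normalized_haar_circle_param:
  "normalized_haar (distr (uniform_measure lborel {0..<1}) circle_borel circle_param)"
    (is "normalized_haar ?M")
  unfolding normalized_haar_def
proof (intro conjI ballI)
  show "sets ?M = sets circle_borel" by simp
  have [measurable]: "circle_param \<in> uniform_measure lborel {0..<1} \<rightarrow>\<^sub>M circle_borel"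
    by simp
  interpret prob_space "uniform_measure lborel {0..<1::real}"
    by (rule prob_space_uniform_measure) auto
  show "prob_space ?M" by (rule prob_space_distr) simp
  fix z :: complex assume z: "z \<in> sphere 0 1"
  obtain s where s: "0 \<le> s" "s < 1" "z = circle_param s" using circle_param_surj[OF z] .
  have zm [measurable]: "(\<lambda>w. z * w) \<in> circle_borel \<rightarrow>\<^sub>M circle_borel"
    using measurable_compose[OF measurable_Pair1'[of z circle_borel circle_borel] circle_mult_measurable] z
    by simp
  have M: "emeasure ?M A = (\<integral>\<^sup>+t\<in>{0..<1}. indicator A (circle_param t) \<partial>lborel)"
    if [measurable]: "A \<in> sets circle_borel" for A
  proof -
    have "emeasure ?M A = (\<integral>\<^sup>+w. indicator A w \<partial>?M)" by simp
    also have "\<dots> = (\<integral>\<^sup>+t. indicator A (circle_param t) \<partial>uniform_measure lborel {0..<1})"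
      by (rule nn_integral_distr) auto
    also have "\<dots> = (\<integral>\<^sup>+t\<in>{0..<1}. indicator A (circle_param t) \<partial>lborel)"
      by (subst nn_integral_uniform_measure)
         (auto intro!: measurable_compose[OF circle_param_measurable] simp: divide_ennreal_def)
    finally show ?thesis .
  qed
  show "distr ?M ?M (\<lambda>w. z * w) = ?M"
  proof (rule measure_eqI)
    fix A assume "A \<in> sets (distr ?M ?M (\<lambda>w. z * w))"
    hence A [measurable]: "A \<in> sets circle_borel" by simp
    define B where "B = (\<lambda>w. z * w) -` A \<inter> sphere 0 1"
    have B: "B \<in> sets circle_borel" using measurable_sets[OF zm A] by (simp add: B_def)
    have "emeasure (distr ?M ?M (\<lambda>w. z * w)) A = emeasure ?M B"
      by (subst emeasure_distr) (auto simp: B_def)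
    also have "\<dots> = (\<integral>\<^sup>+t\<in>{0..<1}. indicator A (circle_param (s + t)) \<partial>lborel)"
      unfolding M[OF B]
      by (intro nn_integral_cong)
         (auto simp: indicator_def B_def s(3) circle_param_add)
    also have "\<dots> = emeasure ?M A"
      unfolding M[OF A] using s(1,2)
      by (intro nn_integral_periodic_shift) (auto intro!: measurable_compose[OF circle_param_measurable])
    finally show "emeasure (distr ?M ?M (\<lambda>w. z * w)) A = emeasure ?M A" .
  qed simp
qed

lemma normalized_haar_unique:
  assumes "normalized_haar M" "normalized_haar N" shows "M = N"
proof (rule measure_eqI)
  have sets_MN [measurable_cong]: "sets M = sets circle_borel" "sets N = sets circle_borel"
    using assms by (auto simp: normalized_haar_def)
  show "sets M = sets N" by (simp add: sets_MN)
  have sp: "space M = sphere 0 1" "space N = sphere 0 1"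
    using sets_eq_imp_space_eq[of M circle_borel] sets_eq_imp_space_eq[of N circle_borel]
      sets_MN by auto
  interpret M: prob_space M using assms by (simp add: normalized_haar_def)
  interpret N: prob_space N using assms by (simp add: normalized_haar_def)
  interpret pair_sigma_finite M N ..
  have inv: "(\<integral>\<^sup>+w. indicator A (z * w) \<partial>K) = emeasure K A"
    if K: "normalized_haar K" and z: "z \<in> sphere 0 1" and A: "A \<in> sets circle_borel" for K z A
  proof -
    have K': "sets K = sets circle_borel" "distr K K (\<lambda>w. z * w) = K"
      using K z by (auto simp: normalized_haar_def)
    have "(\<lambda>w. z * w) \<in> circle_borel \<rightarrow>\<^sub>M circle_borel"
      using measurable_compose[OF measurable_Pair1'[of z circle_borel circle_borel] circle_mult_measurable] z
      by simp
    hence m: "(\<lambda>w. z * w) \<in> K \<rightarrow>\<^sub>M K"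
      using measurable_cong_sets[OF K'(1) K'(1)] by simp
    have "emeasure K A = (\<integral>\<^sup>+w. indicator A w \<partial>distr K K (\<lambda>w. z * w))"
      using A by (simp add: K')
    also have "\<dots> = (\<integral>\<^sup>+w. indicator A (z * w) \<partial>K)"
      using A by (intro nn_integral_distr m borel_measurable_indicator) (simp add: K'(1))
    finally show ?thesis by simp
  qed
  fix A assume "A \<in> sets M"
  hence A [measurable]: "A \<in> sets circle_borel" by (simp add: sets_MN)
  have meas: "(\<lambda>x. indicator A (fst x * snd x) :: ennreal) \<in> borel_measurable (M \<Otimes>\<^sub>M N)"
    using measurable_compose[OF circle_mult_measurable borel_measurable_indicator[OF A]]
    by (simp add: case_prod_unfold cong: measurable_cong_sets sets_pair_measure_cong)
  have "emeasure N A = (\<integral>\<^sup>+z. emeasure N A \<partial>M)" by (simp add: M.emeasure_space_1)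
  also have "\<dots> = (\<integral>\<^sup>+z. \<integral>\<^sup>+w. indicator A (z * w) \<partial>N \<partial>M)"
    by (intro nn_integral_cong) (simp add: inv[OF assms(2)] sp A)
  also have "\<dots> = (\<integral>\<^sup>+w. \<integral>\<^sup>+z. indicator A (z * w) \<partial>M \<partial>N)"
    using Fubini[OF meas] by simp
  also have "\<dots> = (\<integral>\<^sup>+w. emeasure M A \<partial>N)"
    by (intro nn_integral_cong) (simp add: inv[OF assms(1)] sp A mult.commute)
  also have "\<dots> = emeasure M A" by (simp add: N.emeasure_space_1)
  finally show "emeasure M A = emeasure N A" by simp
qed

lemma ex1_normalized_haar: "\<exists>!M. normalized_haar M"
  using normalized_haar_circle_param normalized_haar_unique by blast

lemma normalized_haar_haar_circle: "normalized_haar haar_circle"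
  unfolding haar_circle_def by (rule theI') (rule ex1_normalized_haar)

lemma haar_circle_eq:
  "haar_circle = distr (uniform_measure lborel {0..<1}) circle_borel circle_param"
  by (rule normalized_haar_unique[OF normalized_haar_haar_circle normalized_haar_circle_param])

lemma finite_torus_indices [simp]: "finite (torus_indices X)"
proof (rule finite_subset)
  show "torus_indices X \<subseteq> {..nat \<lfloor>X\<rfloor>} \<times> {..nat \<lfloor>X\<rfloor>}"
    by (auto simp: torus_indices_def le_nat_floor)
qed simp

lemma monom_minus_one_nonzero: "n > 0 \<Longrightarrow> monom (1::complex) n - 1 \<noteq> 0"
proof
  assume "n > 0" "monom (1::complex) n - 1 = 0"
  hence "coeff (monom (1::complex) n - 1) n = 0" by simp
  thus False using \<open>n > 0\<close> by simp
qed

lemma degree_monom_minus_one: "n > 0 \<Longrightarrow> degree (monom (1::complex) n - 1) = n"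
  using degree_add_eq_left[of "-1" "monom (1::complex) n"] by (simp add: degree_monom_eq)

lemma monom_minus_one_dvd:
  assumes "m dvd n" shows "monom (1::complex) m - 1 dvd monom 1 n - 1"
proof -
  obtain k where k: "n = m * k" using assms by blast
  have "monom (1::complex) n = monom 1 m ^ k" by (simp add: k monom_power)
  thus ?thesis
    by (simp add: power_diff_1_eq)
qed

lemma prod_monom_minus_one_dvd:
  fixes c :: "complex poly"
  assumes "monom 1 p - 1 dvd c" "monom 1 q - 1 dvd c" "p > 0"
  shows "(monom 1 p - 1) * (monom 1 q - 1) dvd c * (monom 1 (gcd p q) - 1)"
proof -
  obtain x y where xy: "p * x = q * y + gcd p q"
    using bezout_nat assms(3) by (metis less_numeral_extra(3))
  define a where "a = monom (1::complex) p - 1"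
  define b where "b = monom (1::complex) q - 1"
  define e where "e = monom (1::complex) (gcd p q) - 1"
  obtain u where u: "monom 1 (p * x) - 1 = a * u"
    using monom_minus_one_dvd[of p "p * x"] by (auto simp: a_def elim: dvdE)
  obtain v where v: "monom 1 (q * y) - 1 = b * v"
    using monom_minus_one_dvd[of q "q * y"] by (auto simp: b_def elim: dvdE)
  obtain c1 where c1: "c = a * c1" using assms(1) by (auto simp: a_def elim: dvdE)
  obtain c2 where c2: "c = b * c2" using assms(2) by (auto simp: b_def elim: dvdE)
  have "monom (1::complex) (p * x) - 1 = monom 1 (gcd p q) * (monom 1 (q * y) - 1) + e"
    unfolding xy e_def by (simp add: algebra_simps mult_monom)
  hence e: "e = a * u - monom 1 (gcd p q) * (b * v)"
    by (simp add: u v algebra_simps)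
  have "c * e = a * (b * c2) * u - monom 1 (gcd p q) * (b * v) * (a * c1)"
    unfolding e right_diff_distrib by (simp add: c1[symmetric] c2[symmetric] mult_ac)
  also have "\<dots> = (a * b) * (c2 * u - monom 1 (gcd p q) * v * c1)"
    by (simp add: algebra_simps)
  finally show ?thesis by (simp add: a_def b_def e_def)
qed

lemma torus_alexander_dvd:
  assumes "p > 0" "q > 0"
  shows "(monom (1::complex) p - 1) * (monom 1 q - 1) dvd
     (monom 1 (lcm p q) - 1) ^ gcd p q * (monom 1 1 - 1)"
proof (cases "gcd p q = 1")
  case False
  moreover have "gcd p q > 0" using assms by simp
  ultimately have "2 \<le> gcd p q" by linarith
  hence "(monom (1::complex) (lcm p q) - 1) ^ 2 dvd (monom 1 (lcm p q) - 1) ^ gcd p q"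
    by (rule le_imp_power_dvd)
  moreover have "(monom (1::complex) p - 1) * (monom 1 q - 1) dvd (monom 1 (lcm p q) - 1) ^ 2"
    unfolding power2_eq_square by (intro mult_dvd_mono monom_minus_one_dvd) auto
  ultimately show ?thesis by (rule dvd_mult2[OF dvd_trans, rotated])
next
  case True
  have "(monom (1::complex) p - 1) * (monom 1 q - 1) dvd
      (monom 1 (lcm p q) - 1) * (monom 1 (gcd p q) - 1)"
    by (intro prod_monom_minus_one_dvd monom_minus_one_dvd assms) auto
  thus ?thesis unfolding True by (simp only: power_one_right)
qed

lemma torus_alexander_exact:
  assumes "p > 0" "q > 0"
  shows "torus_alexander p q * ((monom 1 p - 1) * (monom 1 q - 1)) =
     (monom 1 (lcm p q) - 1) ^ gcd p q * (monom 1 1 - 1)"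
  using torus_alexander_dvd[OF assms] by (simp add: torus_alexander_def)

lemma torus_alexander_nonzero:
  assumes "p > 0" "q > 0" shows "torus_alexander p q \<noteq> 0"
proof
  assume "torus_alexander p q = 0"
  hence "(monom (1::complex) (lcm p q) - 1) ^ gcd p q * (monom 1 1 - 1) = 0"
    using torus_alexander_exact[OF assms] by (simp only: mult_zero_left)
  moreover have "monom (1::complex) (lcm p q) - 1 \<noteq> 0" "monom (1::complex) 1 - 1 \<noteq> 0"
    using assms by (intro monom_minus_one_nonzero; simp add: lcm_pos_nat)+
  ultimately show False by (simp only: mult_eq_0_iff power_eq_0_iff simp_thms)
qed

lemma degree_torus_alexander:
  assumes "p > 0" "q > 0"
  shows "degree (torus_alexander p q) + p + q = lcm p q * gcd p q + 1"
proof -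
  define a b c e where defs:
    "a = monom (1::complex) p - 1" "b = monom (1::complex) q - 1"
    "c = monom (1::complex) (lcm p q) - 1" "e = monom (1::complex) 1 - 1"
  have l: "lcm p q > 0" using assms by (simp add: lcm_pos_nat)
  have nz: "a \<noteq> 0" "b \<noteq> 0" "c \<noteq> 0" "e \<noteq> 0"
    unfolding defs by (rule monom_minus_one_nonzero, (rule assms l | simp))+
  have deg: "degree a = p" "degree b = q" "degree c = lcm p q" "degree e = 1"
    unfolding defs by (rule degree_monom_minus_one, (rule assms l | simp))+
  have "degree (torus_alexander p q * (a * b)) = degree (torus_alexander p q) + (p + q)"
    using torus_alexander_nonzero[OF assms] nz deg by (simp add: degree_mult_eq)
  moreover have "degree (c ^ gcd p q * e) = gcd p q * lcm p q + 1"
    using nz deg by (simp add: degree_mult_eq degree_power_eq)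
  ultimately show ?thesis
    using torus_alexander_exact[OF assms] by (simp add: defs mult.commute)
qed

lemma torus_alexander_root_unity:
  assumes "p > 0" "q > 0" "poly (torus_alexander p q) \<alpha> = 0"
  shows "\<alpha> ^ lcm p q = 1"
proof -
  have "poly (torus_alexander p q * ((monom 1 p - 1) * (monom 1 q - 1))) \<alpha> = 0"
    using assms by simp
  hence "(\<alpha> ^ lcm p q - 1) ^ gcd p q * (\<alpha> - 1) = 0"
    unfolding torus_alexander_exact[OF assms(1,2)] by (simp add: poly_monom)
  thus ?thesis by auto
qed

lemma torus_alexander_root_on_circle:
  assumes "p > 0" "q > 0" "poly (torus_alexander p q) \<alpha> = 0"
  shows "\<alpha> \<in> sphere 0 1"
proof -
  have "lcm p q > 0" using assms by (simp add: lcm_pos_nat)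
  moreover have "norm \<alpha> ^ lcm p q = 1"
    using torus_alexander_root_unity[OF assms] by (metis norm_one norm_power)
  ultimately show ?thesis using power_eq_imp_eq_base[of "norm \<alpha>" "lcm p q" 1] by simp
qed

lemma set_Omega:
  "set_mset (Omega X) =
     {((p, q), \<alpha>). (p, q) \<in> torus_indices X \<and> poly (torus_alexander p q) \<alpha> = 0}"
proof -
  have "set_mset (Omega X) = (\<Union>(p, q)\<in>torus_indices X.
      Pair (p, q) ` set_mset (proots (torus_alexander p q)))"
    unfolding Omega_def by (subst set_mset_sum) (auto simp: case_prod_unfold)
  also have "\<dots> = (\<Union>(p, q)\<in>torus_indices X. Pair (p, q) ` {\<alpha>. poly (torus_alexander p q) \<alpha> = 0})"
    by (intro SUP_cong refl) (auto simp: torus_indices_def torus_alexander_nonzero)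
  finally show ?thesis by auto
qed

lemma finite_Omega1 [simp]: "finite (Omega1 X)"
  by (rule finite_subset[OF _ finite_set_mset[of "Omega X"]]) (auto simp: set_Omega Omega1_def)

lemma Omega1_nonempty:
  assumes "X \<ge> 3" shows "Omega1 X \<noteq> {}"
proof -
  have "degree (torus_alexander 2 3) = 2"
    using degree_torus_alexander[of 2 3] prod_gcd_lcm_nat[of 2 3] by (simp add: mult.commute)
  then obtain \<alpha> where "poly (torus_alexander 2 3) \<alpha> = 0"
    using fundamental_theorem_of_algebra[of "torus_alexander 2 3"]
    by (auto simp: constant_degree)
  moreover have "coprime (2::nat) 3" by simp
  ultimately have "((2, 3), \<alpha>) \<in> Omega1 X" using assms
    by (simp add: Omega1_def torus_indices_def)
  thus ?thesis by blast
qed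

lemma Omega_nonempty:
  assumes "X \<ge> 3" shows "Omega X \<noteq> {#}"
proof -
  have "Omega1 X \<subseteq> set_mset (Omega X)" by (auto simp: Omega1_def set_Omega)
  thus ?thesis using Omega1_nonempty[OF assms] by auto
qed

lemma space_dirac_average [simp]: "space (dirac_average S) = sphere 0 1"
  unfolding dirac_average_def using sets.space_closed[of circle_borel]
  by (simp add: space_measure_of)

lemma sets_dirac_average [simp]: "sets (dirac_average S) = sets circle_borel"
  unfolding dirac_average_def using sets.sets_measure_of_eq[of circle_borel] by simp

lemma emeasure_dirac_average:
  assumes "A \<in> sets circle_borel"
  shows "emeasure (dirac_average S) A =
     (\<Sum>(k, \<alpha>)\<in>#S. emeasure (return circle_borel \<alpha>) A) / of_nat (size S)"
proof -
  have *: "(\<Sum>i. \<Sum>(k, \<alpha>)\<in>#S. emeasure (return circle_borel \<alpha>) (B i)) =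
      (\<Sum>(k, \<alpha>)\<in>#S. emeasure (return circle_borel \<alpha>) (\<Union>i. B i))"
    if "range B \<subseteq> sets circle_borel" "disjoint_family B"
    for B :: "nat \<Rightarrow> complex set"
  proof (induction S)
    case (add x S)
    obtain k \<alpha> where x: "x = (k, \<alpha>)" by (cases x)
    have "(\<Sum>i. emeasure (return circle_borel \<alpha>) (B i)) = emeasure (return circle_borel \<alpha>) (\<Union>i. B i)"
      using that by (intro suminf_emeasure) auto
    with add show ?case by (simp add: x suminf_add[symmetric])
  qed simp
  show ?thesis
    unfolding dirac_average_def
  proof (rule emeasure_measure_of_sigma[OF sets.sigma_algebra_axioms _ _ assms])
    show "positive (sets circle_borel)
        (\<lambda>A. (\<Sum>(k, \<alpha>)\<in>#S. emeasure (return circle_borel \<alpha>) A) / of_nat (size S))"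
      by (simp add: positive_def case_prod_unfold)
    show "countably_additive (sets circle_borel)
        (\<lambda>A. (\<Sum>(k, \<alpha>)\<in>#S. emeasure (return circle_borel \<alpha>) A) / of_nat (size S))"
      unfolding countably_additive_def divide_ennreal_def ennreal_suminf_multc
      by (intro allI impI arg_cong2[where f = "(*)"] * refl)
  qed
qed

lemma prob_space_dirac_average:
  assumes "S \<noteq> {#}" "\<And>k \<alpha>. (k, \<alpha>) \<in># S \<Longrightarrow> \<alpha> \<in> sphere 0 1"
  shows "prob_space (dirac_average S)"
proof
  have "(\<Sum>(k, \<alpha>)\<in>#S. emeasure (return circle_borel \<alpha>) (sphere 0 1)) = (\<Sum>x\<in>#S. 1)"
    using assms(2) sets.top[of circle_borel]
    by (intro arg_cong[of _ _ sum_mset] image_mset_cong) (auto simp: emeasure_return)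
  moreover have "sphere 0 1 \<in> sets circle_borel" using sets.top[of circle_borel] by simp
  moreover have "(of_nat (size S) :: ennreal) / of_nat (size S) = 1"
    using assms(1) by (intro ennreal_divide_self) (auto simp: ennreal_of_nat_eq_real_of_nat)
  ultimately show "emeasure (dirac_average S) (space (dirac_average S)) = 1"
    by (simp add: emeasure_dirac_average)
qed

lemma prob_space_root_measure: "Omega X \<noteq> {#} \<Longrightarrow> prob_space (root_measure X)"
  unfolding root_measure_def
  by (rule prob_space_dirac_average)
     (auto simp: set_Omega torus_indices_def dest: torus_alexander_root_on_circle[rotated 2])

lemma prob_space_root_measure1:
  assumes "Omega1 X \<noteq> {}" shows "prob_space (root_measure1 X)"
  unfolding root_measure1_def
proof (rule prob_space_dirac_average)
  show "mset_set (Omega1 X) \<noteq> {#}" using assms by (simp add: mset_set_empty_iff)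
  fix k \<alpha> assume "(k, \<alpha>) \<in># mset_set (Omega1 X)"
  hence "(k, \<alpha>) \<in> Omega1 X" by simp
  thus "\<alpha> \<in> sphere 0 1"
    unfolding Omega1_def torus_indices_def
    using torus_alexander_root_on_circle[of "fst k" "snd k" \<alpha>] by (auto simp: Suc_le_eq)
qed

end

theory Submission
  imports Defs "HOL-Real_Asymp.Real_Asymp"
begin

text \<open>For a continuous function f on the circle with Haar mean I, the sum of f over the n-th roots
  of unity is a Riemann sum, hence n I up to an error of at most e n + C for any e > 0. By the
  formula for the Alexander polynomial, the roots of T(p,q) are d copies of the L-th roots of unity
  and one 1, minus the p-th and q-th roots of unity, so the sum of f over them is (p - 1)(q - 1) I
  up to an error of at most e (p - 1)(q - 1) + C d. Equidistribution along a family of pairs (p,q)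
  therefore follows once the sum of the gcds d is negligible against the number (p - 1)(q - 1) of
  roots. Over all pairs up to n, the former is at most n^3 and the latter of order n^4; over the
  coprime pairs, the former is at most n^2, and the pairs (p, p + 1) alone give of order n^3 roots.\<close>

section \<open>Riemann sums over the roots of unity\<close>

lemma circle_param_uniformly_continuous:
  fixes f :: "complex \<Rightarrow> real"
  assumes "continuous_on (sphere 0 1) f" "e > 0"
  shows "\<exists>d>0. \<forall>s t. \<bar>s - t\<bar> < d \<longrightarrow> \<bar>f (circle_param s) - f (circle_param t)\<bar> < e"
proof -
  have "uniformly_continuous_on (sphere 0 1) f"
    by (rule compact_uniformly_continuous[OF assms(1)]) simp
  then obtain d where d: "d > 0"
    "\<And>z w. z \<in> sphere 0 1 \<Longrightarrow> w \<in> sphere 0 1 \<Longrightarrow> dist w z < d \<Longrightarrow> dist (f w) (f z) < e"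
    using assms(2) unfolding uniformly_continuous_on_def by metis
  \<comment> \<open>A chord is no longer than its arc, so \<open>circle_param\<close> is Lipschitz
    with constant 2 pi and a modulus d on the circle becomes d / (2 pi) in the parameter.\<close>
  have "dist (circle_param s) (circle_param t) \<le> 2 * pi * \<bar>s - t\<bar>" for s t
  proof -
    have "circle_param s - circle_param t = circle_param t * (circle_param (s - t) - 1)"
      by (simp add: right_diff_distrib flip: circle_param_add)
    hence "dist (circle_param s) (circle_param t) = cmod (exp (\<i> * of_real (2 * pi * (s - t))) - 1)"
      by (simp add: dist_norm norm_mult) (simp add: circle_param_def cis_conv_exp)
    also have "\<dots> \<le> \<bar>2 * pi * (s - t)\<bar>"
      using dist_exp_i_1[of "2 * pi * (s - t)"] abs_sin_x_le_abs_x[of "2 * pi * (s - t) / 2"]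
      by simp
    finally show ?thesis by (simp add: abs_mult)
  qed
  moreover have "2 * pi * x < d" if "x < d / (2 * pi)" for x
    using that by (simp add: field_simps)
  ultimately have "dist (circle_param s) (circle_param t) < d" if "\<bar>s - t\<bar> < d / (2 * pi)" for s t
    using that le_less_trans by blast
  hence "\<bar>f (circle_param s) - f (circle_param t)\<bar> < e" if "\<bar>s - t\<bar> < d / (2 * pi)" for s t
    using d(2)[of "circle_param t" "circle_param s"] that by (simp add: dist_real_def)
  thus ?thesis using d(1) by (intro exI[of _ "d / (2 * pi)"]) auto
qed

text \<open>On each cell of width h the function stays within e of its value at the left endpoint,
  so a cell costs at most h * e. The width h is independent of m, so that induction on m can add one
  cell at a time; the application has h = 1/n and m = n.\<close>

lemma riemann_sum_error:
  fixes g :: "real \<Rightarrow> real"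
  assumes g: "continuous_on UNIV g" and h: "h \<ge> 0"
    and e: "\<And>s t. \<bar>s - t\<bar> \<le> h \<Longrightarrow> \<bar>g s - g t\<bar> \<le> e"
  shows "\<bar>integral {0..real m * h} g - h * (\<Sum>k<m. g (real k * h))\<bar> \<le> real m * h * e"
proof (induction m)
  case (Suc m)
  have int: "g integrable_on {a..b}" for a b
    by (rule integrable_continuous_real) (rule continuous_on_subset[OF g], simp)
  define J where "J = {real m * h..real (Suc m) * h}"
  have "integral {0..real m * h} g + integral J g = integral {0..real (Suc m) * h} g"
    unfolding J_def by (intro Henstock_Kurzweil_Integration.integral_combine int)
      (use h in \<open>auto intro: mult_right_mono\<close>)
  moreover have "\<bar>integral J (\<lambda>t. g t - g (real m * h))\<bar> \<le> e * h"
    unfolding real_norm_def[symmetric] J_def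
    by (rule order.trans[OF integral_bound[of _ _ _ e]])
       (use h e in \<open>auto intro!: continuous_intros continuous_on_subset[OF g] mult_right_mono simp: algebra_simps\<close>)
  moreover have "integral J (\<lambda>t. g t - g (real m * h)) = integral J g - h * g (real m * h)"
    unfolding J_def using h by (subst integral_diff) (auto intro!: int simp: algebra_simps)
  ultimately show ?case using Suc by (simp add: algebra_simps)
qed simp

lemma continuous_on_circle_param:
  assumes "continuous_on (sphere 0 1) f"
  shows "continuous_on A (\<lambda>t. f (circle_param t))"
  by (rule continuous_on_compose2[OF assms])
     (auto simp: circle_param_def intro!: continuous_intros)

lemma measurable_circle_borel:
  assumes "continuous_on (sphere 0 1) f"
  shows "f \<in> borel_measurable circle_borel"
  unfolding circle_borel_def by (rule borel_measurable_continuous_on_restrict[OF assms])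

lemma integral_haar_circle:
  fixes f :: "complex \<Rightarrow> real"
  assumes "continuous_on (sphere 0 1) f"
  shows "(\<integral>z. f z \<partial>haar_circle) = integral {0..1} (\<lambda>t. f (circle_param t))"
proof -
  define g where "g = (\<lambda>t. f (circle_param t))"
  have g [measurable]: "g \<in> borel_measurable borel"
    unfolding g_def by (intro borel_measurable_continuous_onI continuous_on_circle_param assms)
  have "(\<integral>z. f z \<partial>haar_circle) = (\<integral>t. g t \<partial>uniform_measure lborel {0..<1})"
    unfolding haar_circle_eq g_def by (rule integral_distr) (auto intro: measurable_circle_borel assms)
  also have "\<dots> = (\<integral>t. indicator {0..<1} t *\<^sub>R g t \<partial>lborel)"
    unfolding uniform_measure_def
    by (subst integral_density[symmetric]) (auto simp: divide_ennreal_def ennreal_indicator)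
  \<comment> \<open>The half-open interval parametrizes the circle once, the closed one fits
    \<open>riemann_sum_error\<close>; they differ by the null set {1}.\<close>
  also have "\<dots> = (LINT t:{0..1}|lborel. g t)"
    unfolding set_lebesgue_integral_def
  proof (rule integral_cong_AE)
    show "AE t in lborel. indicator {0..<1} t *\<^sub>R g t = indicator {0..1} t *\<^sub>R g t"
      using AE_lborel_singleton[of "1::real"] by eventually_elim (auto simp: indicator_def)
  qed simp_all
  also have "\<dots> = integral {0..1} g"
    by (intro set_borel_integral_eq_integral borel_integrable_atLeastAtMost')
       (simp add: g_def continuous_on_circle_param assms)
  finally show ?thesis by (simp add: g_def)
qed

text \<open>The argument is written k * (1 / n) to match the sample points of
  \<open>riemann_sum_error\<close> with h = 1/n.\<close>

lemma roots_of_unity_sum: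
  assumes "n > 0"
  shows "(\<Sum>z | z ^ n = 1. f z) = (\<Sum>k<n. f (circle_param (real k * (1 / real n))))"
  using sum.reindex_bij_betw[OF Complex.bij_betw_roots_unity[OF assms], of f, symmetric]
  by (simp add: circle_param_def)

text \<open>Once the mesh 1/n is below the modulus of continuity for e, the Riemann sum error is at
  most e, hence e n after scaling. The constant C covers the finitely many smaller n: the bound is
  applied to every p and q, including a small p next to a large q.\<close>

lemma roots_of_unity_equidistributed:
  fixes f :: "complex \<Rightarrow> real"
  assumes f: "continuous_on (sphere 0 1) f" and e: "e > 0"
  obtains C where "C \<ge> 0" "\<And>n. n > 0 \<Longrightarrow>
    \<bar>(\<Sum>z | z ^ n = 1. f z) - real n * (\<integral>z. f z \<partial>haar_circle)\<bar> \<le> e * real n + C"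
proof -
  define err where "err = (\<lambda>n. \<bar>(\<Sum>z | z ^ n = 1. f z) - real n * (\<integral>z. f z \<partial>haar_circle)\<bar>)"
  obtain d where d: "d > 0" "\<And>s t. \<bar>s - t\<bar> < d \<Longrightarrow> \<bar>f (circle_param s) - f (circle_param t)\<bar> < e"
    using circle_param_uniformly_continuous[OF f e] by blast
  \<comment> \<open>The threshold from which the mesh 1/n is smaller than d.\<close>
  obtain M where M: "real M > 1 / d" using reals_Archimedean2 by blast
  have large: "err n \<le> e * real n" if "n \<ge> M" for n
  proof -
    have n: "real n > 1 / d" using M that by linarith
    moreover have "1 / d > 0" using d by simp
    ultimately have n0: "n > 0" by (intro gr0I) auto
    have hd: "1 / real n < d" using n n0 d(1) by (simp add: field_simps)
    have "\<bar>integral {0..real n * (1 / real n)} (\<lambda>t. f (circle_param t)) -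
        1 / real n * (\<Sum>k<n. f (circle_param (real k * (1 / real n))))\<bar> \<le> real n * (1 / real n) * e"
    proof (rule riemann_sum_error)
      show "\<bar>f (circle_param s) - f (circle_param t)\<bar> \<le> e" if "\<bar>s - t\<bar> \<le> 1 / real n" for s t
        using d(2)[of s t] hd that by simp
    qed (auto intro: continuous_on_circle_param f)
    hence "\<bar>(\<integral>z. f z \<partial>haar_circle) - (\<Sum>z | z ^ n = 1. f z) / real n\<bar> \<le> e"
      using n0 by (simp add: integral_haar_circle[OF f] roots_of_unity_sum)
    hence "real n * \<bar>(\<integral>z. f z \<partial>haar_circle) - (\<Sum>z | z ^ n = 1. f z) / real n\<bar> \<le> real n * e"
      by (intro mult_left_mono) auto
    also have "real n * \<bar>(\<integral>z. f z \<partial>haar_circle) - (\<Sum>z | z ^ n = 1. f z) / real n\<bar> =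
        \<bar>real n * ((\<integral>z. f z \<partial>haar_circle) - (\<Sum>z | z ^ n = 1. f z) / real n)\<bar>"
      by (simp add: abs_mult)
    also have "\<dots> = err n"
      using n0 by (simp add: err_def right_diff_distrib abs_minus_commute)
    finally show ?thesis by (simp add: mult.commute)
  qed
  \<comment> \<open>Below M a single error is bounded by the sum of all errors below M, which serves
    as C.\<close>
  have "err n \<le> e * real n + (\<Sum>k<M. err k)" for n
  proof (cases "n < M")
    case True
    hence "err n \<le> (\<Sum>k<M. err k)" by (intro member_le_sum) (auto simp: err_def)
    thus ?thesis using e by (simp add: add_increasing)
  next
    case False
    thus ?thesis using large[of n] by (simp add: add_increasing2 sum_nonneg err_def)
  qed
  thus ?thesis by (intro that[of "\<Sum>k<M. err k"]) (auto simp: err_def sum_nonneg)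
qed

section \<open>Integrals against averages of point masses\<close>

lemma sum_mset_nth: "(\<Sum>x\<in>#mset xs. h x) = (\<Sum>i<length xs. h (xs ! i))"
  by (simp add: sum_mset_sum_list sum_list_sum_nth atLeast0LessThan flip: mset_map)

text \<open>Listing the multiset turns multiplicity into repeated positions. The average of point
  masses is then the image of the uniform distribution on positions, and the integral can be pulled
  back to a finite sum.\<close>

lemma integral_dirac_average:
  fixes f :: "complex \<Rightarrow> real"
  assumes f: "continuous_on (sphere 0 1) f" and S: "S \<noteq> {#}"
    "\<And>k \<alpha>. (k, \<alpha>) \<in># S \<Longrightarrow> \<alpha> \<in> sphere 0 1"
  shows "(\<integral>z. f z \<partial>dirac_average S) = (\<Sum>(k, \<alpha>)\<in>#S. f \<alpha>) / real (size S)"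
proof -
  obtain xs where xs: "mset xs = S" using ex_mset by blast
  define n where "n = length xs"
  have n: "n > 0" using xs S(1) by (cases xs) (auto simp: n_def)
  hence ne: "{..<n} \<noteq> {}" by blast
  \<comment> \<open>The default 1 is a point of the circle: the underlying space of the pmf is all
    of the naturals, and \<open>X\<close> has to map every one of them into the circle.\<close>
  define X where "X = (\<lambda>i. if i < n then snd (xs ! i) else 1)"
  have norm_X: "norm (X i) = 1" for i
    using S(2)[of "fst (xs ! i)" "snd (xs ! i)"] nth_mem_mset[of i xs]
    by (simp add: X_def n_def xs)
  have X [measurable]: "X \<in> pmf_of_set {..<n} \<rightarrow>\<^sub>M circle_borel"
    by (simp add: norm_X)
  have "dirac_average S = distr (pmf_of_set {..<n}) circle_borel X"
  proof (rule measure_eqI)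
    fix A assume "A \<in> sets (dirac_average S)"
    hence A [measurable]: "A \<in> sets circle_borel" by simp
    have "emeasure (distr (pmf_of_set {..<n}) circle_borel X) A =
        (\<integral>\<^sup>+z. indicator A z \<partial>distr (pmf_of_set {..<n}) circle_borel X)"
      by simp
    also have "\<dots> = (\<integral>\<^sup>+i. indicator A (X i) \<partial>pmf_of_set {..<n})"
      by (rule nn_integral_distr) (auto simp: norm_X)
    also have "\<dots> = (\<Sum>i<n. indicator A (X i)) / of_nat n"
      using n ne by (subst nn_integral_pmf_of_set) (auto simp: ennreal_of_nat_eq_real_of_nat)
    also have "\<dots> = emeasure (dirac_average S) A"
      using sum_mset_nth[of "\<lambda>(k, \<alpha>). indicator A \<alpha> :: ennreal" xs]
      by (simp add: emeasure_dirac_average n_def X_def case_prod_unfold flip: xs)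
    finally show "emeasure (dirac_average S) A = emeasure (distr (pmf_of_set {..<n}) circle_borel X) A"
      by simp
  qed simp
  hence "(\<integral>z. f z \<partial>dirac_average S) = (\<integral>i. f (X i) \<partial>pmf_of_set {..<n})"
    by (simp add: integral_distr measurable_circle_borel f norm_X)
  also have "\<dots> = (\<Sum>i<n. f (X i)) / real n"
    using n ne by (subst integral_pmf_of_set) auto
  finally show ?thesis
    using sum_mset_nth[of "\<lambda>(k, \<alpha>). f \<alpha>" xs]
    by (simp add: n_def X_def case_prod_unfold flip: xs)
qed

section \<open>The roots of the Alexander polynomial\<close>

lemma proots_monom_minus_one:
  assumes "n > 0"
  shows "proots (monom (1::complex) n - 1) = mset_set {z. z ^ n = 1}"
proof -
  have "set_mset (proots (monom (1::complex) n - 1)) = {z. z ^ n = 1}"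
    using monom_minus_one_nonzero[OF assms] by (simp add: poly_monom)
  hence "mset_set {z. z ^ n = 1} \<subseteq># proots (monom (1::complex) n - 1)"
    using mset_set_set_mset_msubset by metis
  \<comment> \<open>There are as many n-th roots of unity as the degree allows, so the inclusion is
    an equality and every root is simple.\<close>
  moreover have "size (mset_set {z::complex. z ^ n = 1}) = size (proots (monom (1::complex) n - 1))"
    using assms by (simp add: size_proots_complex degree_monom_minus_one card_roots_unity_eq)
  ultimately show ?thesis
    by (metis mset_subset_size nat_less_le subset_mset.le_imp_less_or_eq)
qed

text \<open>These are the root multisets of the two sides of \<open>torus_alexander_exact\<close>.
  The roots of the denominator stay on the left as summands, which avoids the truncated subtraction
  of multisets.\<close>

lemma proots_torus_alexander:
  assumes "p > 0" "q > 0"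
  shows "proots (torus_alexander p q) + mset_set {z. z ^ p = 1} + mset_set {z. z ^ q = 1} =
    repeat_mset (gcd p q) (mset_set {z. z ^ lcm p q = 1}) + {#1#}"
proof -
  have l: "lcm p q > 0" using assms by (simp add: lcm_pos_nat)
  note nz = monom_minus_one_nonzero[OF assms(1)] monom_minus_one_nonzero[OF assms(2)]
    monom_minus_one_nonzero[OF l] monom_minus_one_nonzero[OF zero_less_one]
  have "proots (torus_alexander p q * ((monom 1 p - 1) * (monom 1 q - 1))) =
      proots (torus_alexander p q) + (mset_set {z. z ^ p = 1} + mset_set {z. z ^ q = 1})"
    using nz assms torus_alexander_nonzero[OF assms]
    by (subst proots_mult proots_monom_minus_one; simp)+
  moreover have "proots ((monom (1::complex) (lcm p q) - 1) ^ gcd p q * (monom 1 1 - 1)) =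
      proots ((monom (1::complex) (lcm p q) - 1) ^ gcd p q) + proots (monom (1::complex) 1 - 1)"
    by (rule proots_mult) (use nz(3,4) in simp_all)
  moreover have "proots (monom (1::complex) 1 - 1) = {#1#}"
    by (subst proots_monom_minus_one) simp_all
  ultimately show ?thesis
    by (simp add: torus_alexander_exact[OF assms] proots_power proots_monom_minus_one[OF l] add.assoc)
qed

lemma sum_torus_alexander_roots:
  fixes f :: "complex \<Rightarrow> real"
  assumes "p > 0" "q > 0"
  shows "(\<Sum>\<alpha>\<in>#proots (torus_alexander p q). f \<alpha>) =
    real (gcd p q) * (\<Sum>z | z ^ lcm p q = 1. f z) + f 1 -
    (\<Sum>z | z ^ p = 1. f z) - (\<Sum>z | z ^ q = 1. f z)"
proof -
  have rep: "(\<Sum>z\<in>#repeat_mset n M. f z) = real n * (\<Sum>z\<in>#M. f z)" for n M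
    by (induction n) (auto simp: algebra_simps)
  show ?thesis
    using arg_cong[OF proots_torus_alexander[OF assms], of "\<lambda>M. \<Sum>z\<in>#M. f z"]
    by (simp add: rep sum_unfold_sum_mset)
qed

lemma degree_torus_alexander_real:
  assumes "p > 0" "q > 0"
  shows "real (degree (torus_alexander p q)) = (real p - 1) * (real q - 1)"
proof -
  have "real (degree (torus_alexander p q) + p + q) = real (p * q + 1)"
    unfolding degree_torus_alexander[OF assms] using prod_gcd_lcm_nat[of p q]
    by (simp add: mult.commute)
  thus ?thesis by (simp add: algebra_simps)
qed

text \<open>For d = 1 the right side of \<open>proots_torus_alexander\<close> contains \<alpha> at
  most once, except that it contains 1 twice. Both copies of 1 are used up by the p-th and q-th
  roots of unity on the left, so no multiplicity exceeds one.\<close>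

lemma torus_alexander_roots_simple:
  assumes "p > 0" "q > 0" "coprime p q"
  shows "proots (torus_alexander p q) = mset_set {\<alpha>. poly (torus_alexander p q) \<alpha> = 0}"
proof (rule multiset_eqI)
  fix \<alpha> :: complex
  have fin: "finite {z::complex. z ^ n = 1}" if "n > 0" for n
    using that by (intro finite_roots_unity) simp
  have l: "lcm p q > 0" using assms by (simp add: lcm_pos_nat)
  have "count (proots (torus_alexander p q)) \<alpha> + count (mset_set {z. z ^ p = 1}) \<alpha> +
      count (mset_set {z. z ^ q = 1}) \<alpha> = count (mset_set {z. z ^ lcm p q = 1}) \<alpha> + count {#1#} \<alpha>"
    using arg_cong[OF proots_torus_alexander[OF assms(1,2)], of "\<lambda>M. count M \<alpha>"] assms(3)
    by simp
  hence "count (proots (torus_alexander p q)) \<alpha> \<le> 1"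
    using assms(1,2) l by (auto simp: count_mset_set' fin split: if_splits)
  moreover have "\<alpha> \<in># proots (torus_alexander p q) \<longleftrightarrow> poly (torus_alexander p q) \<alpha> = 0"
    using torus_alexander_nonzero[OF assms(1,2)] by simp
  moreover have "count (proots (torus_alexander p q)) \<alpha> = 0 \<longleftrightarrow> \<alpha> \<notin># proots (torus_alexander p q)"
    by (simp only: not_in_iff)
  ultimately show "count (proots (torus_alexander p q)) \<alpha> =
      count (mset_set {\<alpha>. poly (torus_alexander p q) \<alpha> = 0}) \<alpha>"
    using poly_roots_finite[OF torus_alexander_nonzero[OF assms(1,2)]]
    unfolding count_mset_set' by (auto simp del: count_proots)
qed

section \<open>Equidistribution along families of links\<close>

lemma torus_root_sum_error:
  fixes f :: "complex \<Rightarrow> real"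
  assumes f: "continuous_on (sphere 0 1) f" and e: "e > 0"
  obtains C where "C \<ge> 0" "\<And>p q. p > 0 \<Longrightarrow> q > 0 \<Longrightarrow>
    \<bar>(\<Sum>\<alpha>\<in>#proots (torus_alexander p q). f \<alpha>) -
       real (degree (torus_alexander p q)) * (\<integral>z. f z \<partial>haar_circle)\<bar>
    \<le> e * real (degree (torus_alexander p q)) + C * real (gcd p q)"
proof -
  define I where "I = (\<integral>z. f z \<partial>haar_circle)"
  define A where "A = (\<lambda>n. \<Sum>z | z ^ n = 1. f z)"
  \<comment> \<open>The factor 1/8 pays for the inequality (a + 1)(b + 1) + (a + 1) + (b + 1) \<le>
    8ab for a, b \<ge> 1, with a = p - 1 and b = q - 1.\<close>
  obtain C where C: "C \<ge> 0" "\<And>n. n > 0 \<Longrightarrow> \<bar>A n - real n * I\<bar> \<le> e / 8 * real n + C"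
    using roots_of_unity_equidistributed[OF f, of "e / 8"] e unfolding A_def I_def by auto
  have "\<bar>(\<Sum>\<alpha>\<in>#proots (torus_alexander p q). f \<alpha>) - real (degree (torus_alexander p q)) * I\<bar>
      \<le> e * real (degree (torus_alexander p q)) + (3 * C + \<bar>f 1 - I\<bar>) * real (gcd p q)"
    if pq: "p > 0" "q > 0" for p q
  proof (cases "p = 1 \<or> q = 1")
    \<comment> \<open>Here there are no roots. The case is separate because the degree vanishes
      while p + q is unbounded, so the errors of the individual sums could not be absorbed by e
      times the degree.\<close>
    case True
    hence "degree (torus_alexander p q) = 0" using degree_torus_alexander_real[OF pq] by auto
    hence "proots (torus_alexander p q) = {#}"
      using size_proots_complex[of "torus_alexander p q"] by simp
    thus ?thesis using C(1) \<open>degree (torus_alexander p q) = 0\<close> by simp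
  next
    case False
    define a b d l where "a = real p - 1" "b = real q - 1" "d = real (gcd p q)" "l = real (lcm p q)"
    note defs = this
    have ab: "a \<ge> 1" "b \<ge> 1" "d \<ge> 1" using pq False by (auto simp: defs Suc_le_eq)
    have dl: "d * l = (a + 1) * (b + 1)"
      using prod_gcd_lcm_nat[of p q] unfolding defs by (metis add.commute diff_add_cancel of_nat_mult)
    \<comment> \<open>The L-th roots occur d times, so their error is scaled by d. The linear part
      only sees dL = pq, but the constant becomes C d: this is where the gcd enters the
      bound.\<close>
    have "d * \<bar>A (lcm p q) - l * I\<bar> \<le> d * (e / 8 * l + C)"
      using C(2)[of "lcm p q"] pq ab(3) by (intro mult_left_mono) (auto simp: defs lcm_pos_nat)
    also have "\<dots> = e / 8 * (d * l) + C * d" by (simp add: algebra_simps)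
    also have "\<dots> = e / 8 * ((a + 1) * (b + 1)) + C * d" by (simp only: dl)
    finally have L: "\<bar>d * (A (lcm p q) - l * I)\<bar> \<le> e / 8 * ((a + 1) * (b + 1)) + C * d"
      using ab(3) by (simp add: abs_mult)
    have P: "\<bar>A p - (a + 1) * I\<bar> \<le> e / 8 * (a + 1) + C"
      and Q: "\<bar>A q - (b + 1) * I\<bar> \<le> e / 8 * (b + 1) + C"
      using C(2)[OF pq(1)] C(2)[OF pq(2)] by (simp_all add: defs)
    have "(\<Sum>\<alpha>\<in>#proots (torus_alexander p q). f \<alpha>) - real (degree (torus_alexander p q)) * I =
        d * A (lcm p q) + f 1 - A p - A q - a * b * I"
      using sum_torus_alexander_roots[OF pq, of f] degree_torus_alexander_real[OF pq]
      by (simp add: A_def defs)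
    \<comment> \<open>Splitting the degree as dL - p - q + 1 gives each of the four terms of the
      root sum its own main term.\<close>
    also have "a * b * I = d * l * I - (a + 1) * I - (b + 1) * I + I"
      unfolding dl by (simp add: algebra_simps)
    finally have eq: "(\<Sum>\<alpha>\<in>#proots (torus_alexander p q). f \<alpha>) - real (degree (torus_alexander p q)) * I =
        d * (A (lcm p q) - l * I) - (A p - (a + 1) * I) - (A q - (b + 1) * I) + (f 1 - I)"
      by (simp add: algebra_simps)
    have "(a - 1) * (b - 1) \<ge> 0" "a \<le> a * b" "b \<le> a * b"
      using ab by (auto simp: mult_le_cancel_left1 mult_le_cancel_right1)
    hence "(a + 1) * (b + 1) + (a + 1) + (b + 1) \<le> 8 * (a * b)"
      using ab by (simp add: algebra_simps)
    hence "e / 8 * ((a + 1) * (b + 1) + (a + 1) + (b + 1)) \<le> e / 8 * (8 * (a * b))"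
      using e by (intro mult_left_mono) auto
    hence "e / 8 * ((a + 1) * (b + 1)) + e / 8 * (a + 1) + e / 8 * (b + 1) \<le> e * (a * b)"
      by (simp only: distrib_left)
    \<comment> \<open>Since d \<ge> 1, the constants from p, q and the extra root 1 also fit under a
      multiple of d.\<close>
    moreover have "C \<le> C * d" "\<bar>f 1 - I\<bar> \<le> \<bar>f 1 - I\<bar> * d"
      using C(1) ab(3) by (simp_all add: mult_le_cancel_left1)
    moreover have "(3 * C + \<bar>f 1 - I\<bar>) * d = 3 * (C * d) + \<bar>f 1 - I\<bar> * d"
      by (simp add: algebra_simps)
    ultimately have "e / 8 * ((a + 1) * (b + 1)) + C * d + (e / 8 * (a + 1) + C) +
        (e / 8 * (b + 1) + C) + \<bar>f 1 - I\<bar> \<le> e * (a * b) + (3 * C + \<bar>f 1 - I\<bar>) * d"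
      by linarith
    moreover have "real (degree (torus_alexander p q)) = a * b"
      using degree_torus_alexander_real[OF pq] by (simp add: defs)
    ultimately show ?thesis
      unfolding eq using L P Q by (simp add: defs(3)[symmetric])
  qed
  thus ?thesis using C(1) by (intro that[of "3 * C + \<bar>f 1 - I\<bar>"]) (auto simp: I_def)
qed

text \<open>Summing \<open>torus_root_sum_error\<close> for e / 2 over \<open>K i\<close> and
  dividing by the number \<open>D i\<close> of roots leaves an error of at most e / 2 + C times the
  ratio in the last hypothesis. As C depends on e but not on the pair, the second term tends to
  0.\<close>

lemma torus_root_average_tendsto:
  fixes f :: "complex \<Rightarrow> real" and K :: "'i \<Rightarrow> (nat \<times> nat) set"
  defines "D \<equiv> \<lambda>i. \<Sum>(p, q)\<in>K i. real (degree (torus_alexander p q))"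
  assumes f: "continuous_on (sphere 0 1) f"
    and pos: "\<And>i p q. (p, q) \<in> K i \<Longrightarrow> p > 0 \<and> q > 0"
    and D: "eventually (\<lambda>i. D i > 0) F"
    and ratio: "((\<lambda>i. (\<Sum>(p, q)\<in>K i. real (gcd p q)) / D i) \<longlongrightarrow> 0) F"
  shows "((\<lambda>i. (\<Sum>(p, q)\<in>K i. \<Sum>\<alpha>\<in>#proots (torus_alexander p q). f \<alpha>) / D i) \<longlongrightarrow>
    (\<integral>z. f z \<partial>haar_circle)) F"
proof (rule tendstoI)
  fix e :: real assume e: "e > 0"
  define I where "I = (\<integral>z. f z \<partial>haar_circle)"
  define s where "s = (\<lambda>(p, q). \<Sum>\<alpha>\<in>#proots (torus_alexander p q). f \<alpha>)"
  define w where "w = (\<lambda>(p, q). real (degree (torus_alexander p q)))"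
  define g where "g = (\<lambda>(p, q). real (gcd p q))"
  obtain C where C: "C \<ge> 0" "\<And>p q. p > 0 \<Longrightarrow> q > 0 \<Longrightarrow>
      \<bar>s (p, q) - w (p, q) * I\<bar> \<le> e / 2 * w (p, q) + C * g (p, q)"
    using torus_root_sum_error[OF f, of "e / 2"] e unfolding I_def s_def w_def g_def by auto
  have "((\<lambda>i. C * (sum g (K i) / D i)) \<longlongrightarrow> C * 0) F"
    unfolding g_def by (intro tendsto_mult tendsto_const ratio)
  hence "eventually (\<lambda>i. C * (sum g (K i) / D i) < e / 2) F"
    by (rule order_tendstoD(2)) (use e in simp)
  with D show "eventually (\<lambda>i. dist ((\<Sum>(p, q)\<in>K i. \<Sum>\<alpha>\<in>#proots (torus_alexander p q). f \<alpha>) / D i) I < e) F"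
  proof eventually_elim
    fix i assume Di: "D i > 0" and small: "C * (sum g (K i) / D i) < e / 2"
    have Dw: "D i = sum w (K i)" by (simp add: D_def w_def)
    have "\<bar>sum s (K i) - D i * I\<bar> = \<bar>\<Sum>k\<in>K i. s k - w k * I\<bar>"
      by (simp add: Dw sum_subtractf sum_distrib_right)
    also have "\<dots> \<le> (\<Sum>k\<in>K i. \<bar>s k - w k * I\<bar>)" by (rule sum_abs)
    also have "\<dots> \<le> (\<Sum>k\<in>K i. e / 2 * w k + C * g k)"
    proof (rule sum_mono)
      fix k assume "k \<in> K i"
      thus "\<bar>s k - w k * I\<bar> \<le> e / 2 * w k + C * g k"
        using pos[of "fst k" "snd k" i] C(2)[of "fst k" "snd k"] by simp
    qed
    also have "\<dots> = e / 2 * D i + C * sum g (K i)"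
      by (simp add: Dw sum.distrib sum_distrib_left)
    finally have le: "\<bar>sum s (K i) - D i * I\<bar> \<le> e / 2 * D i + C * sum g (K i)" .
    have "dist (sum s (K i) / D i) I = \<bar>(sum s (K i) - D i * I) / D i\<bar>"
      using Di by (simp add: dist_real_def diff_divide_distrib)
    also have "\<dots> = \<bar>sum s (K i) - D i * I\<bar> / D i" using Di by simp
    also have "\<dots> \<le> (e / 2 * D i + C * sum g (K i)) / D i"
      using le Di by (intro divide_right_mono) auto
    also have "\<dots> = e / 2 + C * (sum g (K i) / D i)" using Di by (simp add: add_divide_distrib)
    also have "\<dots> < e" using small by linarith
    finally show "dist ((\<Sum>(p, q)\<in>K i. \<Sum>\<alpha>\<in>#proots (torus_alexander p q). f \<alpha>) / D i) I < e"
      by (simp add: s_def)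
  qed
qed

lemma torus_indices_eq: "torus_indices X = {1..nat \<lfloor>X\<rfloor>} \<times> {1..nat \<lfloor>X\<rfloor>}"
proof (rule set_eqI, rule prod.induct)
  fix p q :: nat
  have iff: "1 \<le> k \<and> real k \<le> X \<longleftrightarrow> 1 \<le> k \<and> k \<le> nat \<lfloor>X\<rfloor>" for k
    by linarith
  show "(p, q) \<in> torus_indices X \<longleftrightarrow> (p, q) \<in> {1..nat \<lfloor>X\<rfloor>} \<times> {1..nat \<lfloor>X\<rfloor>}"
    unfolding torus_indices_def mem_Collect_eq case_prod_conv mem_Sigma_iff atLeastAtMost_iff
    using iff[of p] iff[of q] by blast
qed

lemma filterlim_nat_floor: "filterlim (\<lambda>x::real. nat \<lfloor>x\<rfloor>) at_top at_top"
  by (rule filterlim_compose[OF filterlim_nat_sequentially filterlim_floor_sequentially])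

text \<open>This passes from real X to n = \<open>nat \<lfloor>X\<rfloor>\<close>, so that only the
  growth of two explicit sequences is left to compare.\<close>

lemma torus_root_average_tendsto_of_bounds:
  fixes f :: "complex \<Rightarrow> real" and K :: "real \<Rightarrow> (nat \<times> nat) set" and L U :: "nat \<Rightarrow> real"
  assumes f: "continuous_on (sphere 0 1) f"
    and K: "\<And>X. K X \<subseteq> torus_indices X"
    and lower: "\<And>X. L (nat \<lfloor>X\<rfloor>) \<le> (\<Sum>(p, q)\<in>K X. real (degree (torus_alexander p q)))"
    and upper: "\<And>X. (\<Sum>(p, q)\<in>K X. real (gcd p q)) \<le> U (nat \<lfloor>X\<rfloor>)"
    and pos: "eventually (\<lambda>n. L n > 0) sequentially"
    and ratio: "(\<lambda>n. U n / L n) \<longlonglongrightarrow> 0"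
  shows "((\<lambda>X. (\<Sum>(p, q)\<in>K X. \<Sum>\<alpha>\<in>#proots (torus_alexander p q). f \<alpha>) /
      (\<Sum>(p, q)\<in>K X. real (degree (torus_alexander p q)))) \<longlongrightarrow> (\<integral>z. f z \<partial>haar_circle)) at_top"
proof (rule torus_root_average_tendsto[OF f])
  show "p > 0 \<and> q > 0" if "(p, q) \<in> K X" for X p q
    using that K by (fastforce simp: torus_indices_def)
  have posX: "eventually (\<lambda>X. L (nat \<lfloor>X\<rfloor>) > 0) (at_top :: real filter)"
    by (rule eventually_compose_filterlim[OF pos filterlim_nat_floor])
  thus "eventually (\<lambda>X. (\<Sum>(p, q)\<in>K X. real (degree (torus_alexander p q))) > 0) at_top"
    by (rule eventually_mono) (rule less_le_trans[OF _ lower])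
  have gcd_nonneg: "0 \<le> (\<Sum>(p, q)\<in>K X. real (gcd p q))" for X
    by (intro sum_nonneg) (simp add: case_prod_unfold)
  show "((\<lambda>X. (\<Sum>(p, q)\<in>K X. real (gcd p q)) /
      (\<Sum>(p, q)\<in>K X. real (degree (torus_alexander p q)))) \<longlongrightarrow> 0) at_top"
  proof (rule tendsto_sandwich[where f = "\<lambda>_. 0"])
    show "((\<lambda>X. U (nat \<lfloor>X\<rfloor>) / L (nat \<lfloor>X\<rfloor>)) \<longlongrightarrow> 0) (at_top :: real filter)"
      by (rule filterlim_compose[OF ratio filterlim_nat_floor])
    show "eventually (\<lambda>X. (\<Sum>(p, q)\<in>K X. real (gcd p q)) /
        (\<Sum>(p, q)\<in>K X. real (degree (torus_alexander p q))) \<le>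
        U (nat \<lfloor>X\<rfloor>) / L (nat \<lfloor>X\<rfloor>)) at_top"
      using posX
    proof (rule eventually_mono)
      show "(\<Sum>(p, q)\<in>K X. real (gcd p q)) / (\<Sum>(p, q)\<in>K X. real (degree (torus_alexander p q))) \<le>
        U (nat \<lfloor>X\<rfloor>) / L (nat \<lfloor>X\<rfloor>)" if "L (nat \<lfloor>X\<rfloor>) > 0" for X
        \<comment> \<open>Lowering the denominator to \<open>L\<close> needs a nonnegative
          numerator; \<open>U\<close> is one because it bounds a sum of gcds.\<close>
        by (rule frac_le[OF order.trans[OF gcd_nonneg upper] upper that lower])
    qed
    show "eventually (\<lambda>X. 0 \<le> (\<Sum>(p, q)\<in>K X. real (gcd p q)) /
        (\<Sum>(p, q)\<in>K X. real (degree (torus_alexander p q)))) at_top"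
      by (intro always_eventually allI divide_nonneg_nonneg gcd_nonneg sum_nonneg)
         (simp add: case_prod_unfold)
  qed simp
qed

section \<open>Growth of the root counts and of the gcd sums\<close>

lemma sum_degree_torus_alexander:
  "(\<Sum>(p, q)\<in>{1..n} \<times> {1..n}. real (degree (torus_alexander p q))) = (real n * (real n - 1) / 2) ^ 2"
proof -
  have "(\<Sum>(p, q)\<in>{1..n} \<times> {1..n}. real (degree (torus_alexander p q))) =
      (\<Sum>(p, q)\<in>{1..n} \<times> {1..n}. (real p - 1) * (real q - 1))"
    by (intro sum.cong) (auto simp: degree_torus_alexander_real)
  also have "\<dots> = (\<Sum>p=1..n. real p - 1) ^ 2"
    by (simp add: power2_eq_square sum_product sum.cartesian_product)
  also have "(\<Sum>p=1..n. real p - 1) = real n * (real n - 1) / 2"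
    by (induction n) (auto simp: field_simps)
  finally show ?thesis .
qed

lemma sum_gcd_le: "(\<Sum>(p, q)\<in>{1..n} \<times> {1..n}. real (gcd p q)) \<le> real n ^ 3"
proof -
  have "(\<Sum>(p, q)\<in>{1..n} \<times> {1..n}. real (gcd p q)) \<le> (\<Sum>(p, q)\<in>{1..n} \<times> {1..n}. real n)"
    by (intro sum_mono) (auto intro!: order.trans[OF gcd_le1_nat])
  thus ?thesis by (simp add: power3_eq_cube)
qed

text \<open>Consecutive integers are coprime, so the pairs (p, p + 1) with p < n belong to the
  family. Their degrees (p - 1) p add up to exactly this cubic, which outgrows the quadratic bound
  of \<open>sum_gcd_coprime_le\<close>.\<close>

lemma sum_degree_coprime_ge:
  "(\<Sum>(p, q) | (p, q) \<in> {1..n} \<times> {1..n} \<and> coprime p q. real (degree (torus_alexander p q))) \<ge>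
    real n * (real n - 1) * (real n - 2) / 3"
proof -
  have "real n * (real n - 1) * (real n - 2) / 3 = (\<Sum>p=1..<n. (real p - 1) * real p)"
    by (induction n) (auto simp: field_simps)
  also have "\<dots> = (\<Sum>p=1..<n. real (degree (torus_alexander p (Suc p))))"
    by (intro sum.cong) (auto simp: degree_torus_alexander_real)
  also have "\<dots> = (\<Sum>(p, q)\<in>(\<lambda>p. (p, Suc p)) ` {1..<n}. real (degree (torus_alexander p q)))"
    by (subst sum.reindex) (auto simp: inj_on_def)
  also have "\<dots> \<le> (\<Sum>(p, q) | (p, q) \<in> {1..n} \<times> {1..n} \<and> coprime p q. real (degree (torus_alexander p q)))"
    by (rule sum_mono2) (auto intro: finite_subset[of _ "{1..n} \<times> {1..n}"])
  finally show ?thesis .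
qed

lemma sum_gcd_coprime_le:
  "(\<Sum>(p, q) | (p, q) \<in> {1..n} \<times> {1..n} \<and> coprime p q. real (gcd p q)) \<le> real n ^ 2"
proof -
  have "(\<Sum>(p, q) | (p, q) \<in> {1..n} \<times> {1..n} \<and> coprime p q. real (gcd p q)) =
      (\<Sum>x | x \<in> {1..n} \<times> {1..n} \<and> (case x of (p, q) \<Rightarrow> coprime p q). 1)"
    by (intro sum.cong) auto
  also have "\<dots> \<le> (\<Sum>x\<in>{1..n} \<times> {1..n}. 1)"
    by (rule sum_mono2) auto
  also have "\<dots> = real n ^ 2" by (simp add: power2_eq_square)
  finally show ?thesis .
qed

section \<open>Integrals against the two root measures\<close>

lemma sum_Omega:
  fixes f :: "complex \<Rightarrow> 'b :: comm_monoid_add"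
  shows "(\<Sum>(k, \<alpha>)\<in>#Omega X. f \<alpha>) =
    (\<Sum>(p, q)\<in>torus_indices X. \<Sum>\<alpha>\<in>#proots (torus_alexander p q). f \<alpha>)"
proof -
  \<comment> \<open>An arbitrary finite index set replaces \<open>torus_indices X\<close> to allow
    induction over it.\<close>
  have "(\<Sum>(k, \<alpha>)\<in>#(\<Sum>(p, q)\<in>K. image_mset (Pair (p, q)) (proots (torus_alexander p q))). f \<alpha>) =
    (\<Sum>(p, q)\<in>K. \<Sum>\<alpha>\<in>#proots (torus_alexander p q). f \<alpha>)" if "finite K" for K
    using that by (induction K) (auto simp: image_mset.compositionality o_def)
  thus ?thesis by (simp add: Omega_def)
qed

text \<open>\<open>Omega1\<close> is a set, whereas the estimates count multiplicities; the two
  agree because the roots are simple for coprime p and q. Values in any commutative monoid serve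
  both the integral of f and, with the constant \<open>1::nat\<close>, the number of roots.\<close>

lemma sum_Omega1:
  fixes f :: "complex \<Rightarrow> 'b :: comm_monoid_add"
  shows "(\<Sum>(k, \<alpha>)\<in>Omega1 X. f \<alpha>) =
    (\<Sum>(p, q) | (p, q) \<in> torus_indices X \<and> coprime p q. \<Sum>\<alpha>\<in>#proots (torus_alexander p q). f \<alpha>)"
proof -
  define K where "K = {(p, q). (p, q) \<in> torus_indices X \<and> coprime p q}"
  define R where "R = (\<lambda>(p, q). {\<alpha>. poly (torus_alexander p q) \<alpha> = 0})"
  have K: "finite K" by (rule finite_subset[OF _ finite_torus_indices[of X]]) (auto simp: K_def)
  have pos: "p > 0" "q > 0" if "(p, q) \<in> K" for p q
    using that by (auto simp: K_def torus_indices_def)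
  have "Omega1 X = Sigma K R" by (auto simp: Omega1_def K_def R_def)
  moreover have "finite (R k)" if "k \<in> K" for k
  proof -
    obtain p q where k: "k = (p, q)" by fastforce
    show ?thesis using poly_roots_finite[OF torus_alexander_nonzero[OF pos]] that
      by (simp add: k R_def)
  qed
  ultimately have "(\<Sum>(k, \<alpha>)\<in>Omega1 X. f \<alpha>) = (\<Sum>k\<in>K. \<Sum>\<alpha>\<in>R k. f \<alpha>)"
    using K by (simp add: sum.Sigma)
  also have "\<dots> = (\<Sum>(p, q)\<in>K. \<Sum>\<alpha>\<in>#proots (torus_alexander p q). f \<alpha>)"
    using pos by (intro sum.cong)
      (auto simp: R_def sum_unfold_sum_mset K_def torus_alexander_roots_simple)
  finally show ?thesis by (simp add: K_def)
qed

text \<open>The bound X \<ge> 3 brings in the trefoil (2, 3), which has roots, so the average is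
  over a nonempty multiset.\<close>

lemma integral_root_measure:
  fixes f :: "complex \<Rightarrow> real"
  assumes f: "continuous_on (sphere 0 1) f" and X: "X \<ge> 3"
  shows "(\<integral>z. f z \<partial>root_measure X) =
    (\<Sum>(p, q)\<in>torus_indices X. \<Sum>\<alpha>\<in>#proots (torus_alexander p q). f \<alpha>) /
    (\<Sum>(p, q)\<in>torus_indices X. real (degree (torus_alexander p q)))"
proof -
  have "real (size (Omega X)) = (\<Sum>(p, q)\<in>torus_indices X. real (degree (torus_alexander p q)))"
    using sum_Omega[of "\<lambda>_. 1::nat" X]
    by (simp add: size_proots_complex case_prod_unfold flip: size_eq_sum_mset)
  moreover have "\<alpha> \<in> sphere 0 1" if "(k, \<alpha>) \<in># Omega X" for k \<alpha>
    using that by (auto simp: set_Omega torus_indices_def dest: torus_alexander_root_on_circle[rotated 2])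
  ultimately show ?thesis
    unfolding root_measure_def using Omega_nonempty[OF X]
    by (simp add: integral_dirac_average f sum_Omega)
qed

lemma integral_root_measure1:
  fixes f :: "complex \<Rightarrow> real"
  assumes f: "continuous_on (sphere 0 1) f" and X: "X \<ge> 3"
  shows "(\<integral>z. f z \<partial>root_measure1 X) =
    (\<Sum>(p, q) | (p, q) \<in> torus_indices X \<and> coprime p q. \<Sum>\<alpha>\<in>#proots (torus_alexander p q). f \<alpha>) /
    (\<Sum>(p, q) | (p, q) \<in> torus_indices X \<and> coprime p q. real (degree (torus_alexander p q)))"
proof -
  have "real (card (Omega1 X)) =
      (\<Sum>(p, q) | (p, q) \<in> torus_indices X \<and> coprime p q. real (degree (torus_alexander p q)))"
    using sum_Omega1[of "\<lambda>_. 1::nat" X]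
    by (simp add: size_proots_complex case_prod_unfold flip: size_eq_sum_mset)
  moreover have circle: "\<alpha> \<in> sphere 0 1" if "(k, \<alpha>) \<in># mset_set (Omega1 X)" for k \<alpha>
  proof -
    have "(k, \<alpha>) \<in> Omega1 X" using that by simp
    hence "(k, \<alpha>) \<in># Omega X" by (auto simp: Omega1_def set_Omega)
    thus ?thesis
      by (auto simp: set_Omega torus_indices_def dest: torus_alexander_root_on_circle[rotated 2])
  qed
  moreover have nonempty: "mset_set (Omega1 X) \<noteq> {#}"
    using Omega1_nonempty[OF X] by (simp add: mset_set_empty_iff)
  moreover have "(\<Sum>(k, \<alpha>)\<in>#mset_set (Omega1 X). f \<alpha>) = (\<Sum>(k, \<alpha>)\<in>Omega1 X. f \<alpha>)"
    by (simp add: sum_unfold_sum_mset)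
  ultimately show ?thesis
    unfolding root_measure1_def
    using integral_dirac_average[OF f nonempty circle] by (simp add: sum_Omega1)
qed

section \<open>Weak convergence of both measures\<close>

lemma space_haar_circle: "space haar_circle = sphere 0 1"
  by (simp add: haar_circle_eq)

theorem theorem3:
  shows "weakly_converges root_measure haar_circle at_top \<and>
         weakly_converges root_measure1 haar_circle at_top"
  unfolding weakly_converges_def space_haar_circle
proof (intro conjI allI impI; elim conjE)
  fix f :: "complex \<Rightarrow> real" assume f: "continuous_on (sphere 0 1) f"
  have "((\<lambda>X. (\<Sum>(p, q)\<in>torus_indices X. \<Sum>\<alpha>\<in>#proots (torus_alexander p q). f \<alpha>) /
      (\<Sum>(p, q)\<in>torus_indices X. real (degree (torus_alexander p q)))) \<longlongrightarrow>
      (\<integral>z. f z \<partial>haar_circle)) at_top"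
  proof (rule torus_root_average_tendsto_of_bounds[OF f subset_refl])
    show "(real (nat \<lfloor>X\<rfloor>) * (real (nat \<lfloor>X\<rfloor>) - 1) / 2) ^ 2 \<le>
        (\<Sum>(p, q)\<in>torus_indices X. real (degree (torus_alexander p q)))" for X
      unfolding torus_indices_eq sum_degree_torus_alexander by (rule order.refl)
    show "(\<Sum>(p, q)\<in>torus_indices X. real (gcd p q)) \<le> real (nat \<lfloor>X\<rfloor>) ^ 3" for X
      unfolding torus_indices_eq by (rule sum_gcd_le)
    show "eventually (\<lambda>n. (real n * (real n - 1) / 2) ^ 2 > 0) sequentially" by real_asymp
    \<comment> \<open>All pairs: a cubic gcd bound against about n^4 / 4 roots.\<close>
    show "(\<lambda>n. real n ^ 3 / (real n * (real n - 1) / 2) ^ 2) \<longlonglongrightarrow> 0" by real_asymp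
  qed
  moreover have "eventually (\<lambda>X. (\<integral>z. f z \<partial>root_measure X) =
      (\<Sum>(p, q)\<in>torus_indices X. \<Sum>\<alpha>\<in>#proots (torus_alexander p q). f \<alpha>) /
      (\<Sum>(p, q)\<in>torus_indices X. real (degree (torus_alexander p q)))) at_top"
    \<comment> \<open>The formula for the integral holds from X = 3 on, which is enough for the
      limit.\<close>
    using eventually_ge_at_top[of 3] by (rule eventually_mono) (rule integral_root_measure[OF f])
  ultimately show "((\<lambda>X. \<integral>z. f z \<partial>root_measure X) \<longlongrightarrow> (\<integral>z. f z \<partial>haar_circle)) at_top"
    using tendsto_cong by fast

  let ?K = "\<lambda>X. {(p, q). (p, q) \<in> torus_indices X \<and> coprime p q}"
  have "((\<lambda>X. (\<Sum>(p, q)\<in>?K X. \<Sum>\<alpha>\<in>#proots (torus_alexander p q). f \<alpha>) /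
      (\<Sum>(p, q)\<in>?K X. real (degree (torus_alexander p q)))) \<longlongrightarrow> (\<integral>z. f z \<partial>haar_circle)) at_top"
  proof (rule torus_root_average_tendsto_of_bounds[OF f])
    show "?K X \<subseteq> torus_indices X" for X by blast
    show "real (nat \<lfloor>X\<rfloor>) * (real (nat \<lfloor>X\<rfloor>) - 1) * (real (nat \<lfloor>X\<rfloor>) - 2) / 3 \<le>
        (\<Sum>(p, q)\<in>?K X. real (degree (torus_alexander p q)))" for X
      unfolding torus_indices_eq by (rule sum_degree_coprime_ge)
    show "(\<Sum>(p, q)\<in>?K X. real (gcd p q)) \<le> real (nat \<lfloor>X\<rfloor>) ^ 2" for X
      unfolding torus_indices_eq by (rule sum_gcd_coprime_le)
    show "eventually (\<lambda>n. real n * (real n - 1) * (real n - 2) / 3 > 0) sequentially" by real_asymp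
    \<comment> \<open>Coprime pairs: a quadratic gcd bound against at least about n^3 / 3
      roots.\<close>
    show "(\<lambda>n. real n ^ 2 / (real n * (real n - 1) * (real n - 2) / 3)) \<longlonglongrightarrow> 0" by real_asymp
  qed
  moreover have "eventually (\<lambda>X. (\<integral>z. f z \<partial>root_measure1 X) =
      (\<Sum>(p, q)\<in>?K X. \<Sum>\<alpha>\<in>#proots (torus_alexander p q). f \<alpha>) /
      (\<Sum>(p, q)\<in>?K X. real (degree (torus_alexander p q)))) at_top"
    using eventually_ge_at_top[of 3] by (rule eventually_mono) (rule integral_root_measure1[OF f])
  ultimately show "((\<lambda>X. \<integral>z. f z \<partial>root_measure1 X) \<longlongrightarrow> (\<integral>z. f z \<partial>haar_circle)) at_top"
    using tendsto_cong by fast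
qed

end
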